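(* Let $\mathcal C=\{\mathcal C_1,\dots,\mathcal C_K\}$ be a clustering of $\mathcal V=\{1,\dots,n\}$, let $T\ge 2$ be an integer, and let $\mathcal G$ be a directed graph on $\mathcal V$ such that: (1) every vertex of $\mathcal G$ has a self-link; (2) for any pair of clusters $\mathcal C_p,\mathcal C_q$, either there are no links in $\mathcal G$ from $\mathcal C_q$ to $\mathcal C_p$, or for each vertex $v\in\mathcal C_p$ there is at least one link in $\mathcal G$ from $\mathcal C_q$ to $v$; (3) $\mathcal G$ has cluster-spanning-trees with respect to $\mathcal C$. Then the system $$x(t+1)=Ax(t)+\varsigma u(t),\qquad t\ge 0,$$ reaches cluster consensus generically with respect to the set $\mathcal T(\mathcal C,\mathcal G)$. That is, for almost every triple $\{B,\tilde\varsigma,[u_1,\dots,u_{T-1}]\}\in\mathcal T(\mathcal C,\mathcal G)$, for every stochastic matrix $A$ with $\mathcal G(A)=\mathcal G$ that has inter-cluster common influence with inter-cluster matrix $B$, and for almost all $x(0)\in\mathbb R^n$, the solution $x(t)$ is bounded, intra-cluster synchronizes and inter-cluster separates. In addition, the limiting consensus trajectories are periodic: there exist real-valued $T$-periodic functions $v_p(t)$, $p=1,\dots,K$, such that $\lim_{t\to\infty}|x_j(t)-v_p(t)|=0$ whenever $j\in\mathcal C_p$.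
   Context: A clustering of $\mathcal V=\{1,\dots,n\}$ is a partition $\mathcal C=\{\mathcal C_1,\dots,\mathcal C_K\}$ of $\mathcal V$. A stochastic matrix is a nonnegative square matrix with all row sums equal to $1$. The directed graph $\mathcal G(A)$ of a nonnegative $n\times n$ matrix $A$ has vertex set $\mathcal V$ and has an edge (link) $(j,i)$ from $j$ to $i$ if and only if $A_{ij}>0$; a self-link is an edge $(i,i)$. A directed graph on $\mathcal V$ has cluster-spanning-trees with respect to $\mathcal C$ if for each $p$ there is a vertex $v_p\in\mathcal V$ (not necessarily in $\mathcal C_p$) with directed paths (possibly of length $0$, possibly through vertices outside $\mathcal C_p$) from $v_p$ to all vertices of $\mathcal C_p$. A stochastic matrix $A$ has inter-cluster common influence with respect to $\mathcal C$ if for every pair $p,q$ the sum $\beta_{p,q}=\sum_{j\in\mathcal C_q}A_{ij}$ is the same for all $i\in\mathcal C_p$; then $B=[\beta_{p,q}]_{p,q=1}^K$ is called its inter-cluster matrix (a $K\times K$ stochastic matrix). The set $\mathcal T(\mathcal C,\mathcal G)$ consists of all triples $\{B,\tilde\varsigma,[u_1,\dots,u_{T-1}]\}$ where $B$ is the inter-cluster matrix of some stochastic matrix $A$ with $\mathcal G(A)=\mathcal G$ and inter-cluster common influence with respect to $\mathcal C$ (under condition (2), these $B$ are exactly the $K\times K$ stochastic matrices with $\beta_{p,q}>0$ if and only if $\mathcal G$ has a link from $\mathcal C_q$ to $\mathcal C_p$), $\tilde\varsigma=[\alpha_1,\dots,\alpha_K]^\top\in\mathbb R^K$, and $[u_1,\dots,u_{T-1}]\in\mathbb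 R^{T-1}$. "Almost every" triple means outside a set of Lebesgue measure zero, where the set of admissible $B$ is given Lebesgue measure on its affine hull; "almost all $x(0)$" is with respect to Lebesgue measure on $\mathbb R^n$. Given a triple, $\varsigma\in\mathbb R^n$ is defined by $\varsigma_i=\alpha_p$ for $i\in\mathcal C_p$, and $u$ is the $T$-periodic real function with $u(\theta+kT)=u_\theta$ for $\theta=1,\dots,T-1$ and $u(kT)=-\sum_{j=1}^{T-1}u_j$, for all $k\ge 0$. $x(t)$ intra-cluster synchronizes if $\lim_{t\to\infty}|x_i(t)-x_{i'}(t)|=0$ for all $i,i'$ in the same cluster. $x(t)$ inter-cluster separates if $\limsup_{t\to\infty}|x_i(t)-x_j(t)|>0$ for every $i\in\mathcal C_k$, $j\in\mathcal C_l$ with $k\ne l$. Cluster consensus means that $x(t)$ is bounded, intra-cluster synchronizes and inter-cluster separates. *)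

theory Defs
  imports "HOL-Analysis.Analysis"
begin

text \<open>
  The vertex set is the finite type \<open>'n\<close>. A clustering into \<open>K\<close> clusters is given by its labelling
  \<open>C :: 'k \<Rightarrow> 'n set\<close> with \<open>K = CARD('k)\<close>. Directed graphs on \<open>'n\<close> are edge sets, where
  \<open>(j, i) \<in> G\<close> is a link from \<open>j\<close> to \<open>i\<close>.
\<close>

definition clustering :: "('k \<Rightarrow> 'n set) \<Rightarrow> bool" where
  "clustering C \<longleftrightarrow> inj C \<and> partition_on UNIV (range C)"

definition stochastic :: "real ^ 'm ^ 'm \<Rightarrow> bool" where
  "stochastic A \<longleftrightarrow> (\<forall>i j. 0 \<le> A $ i $ j) \<and> (\<forall>i. (\<Sum>j\<in>UNIV. A $ i $ j) = 1)"

definition matrix_graph :: "real ^ 'n ^ 'n \<Rightarrow> ('n \<times> 'n) set" where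
  "matrix_graph A = {(j, i). A $ i $ j > 0}"

definition cluster_spanning_trees :: "('k \<Rightarrow> 'n set) \<Rightarrow> ('n \<times> 'n) set \<Rightarrow> bool" where
  "cluster_spanning_trees C G \<longleftrightarrow> (\<forall>p. \<exists>v. \<forall>w\<in>C p. (v, w) \<in> G\<^sup>*)"

definition common_influence :: "('k \<Rightarrow> 'n set) \<Rightarrow> real ^ 'n ^ 'n \<Rightarrow> bool" where
  "common_influence C A \<longleftrightarrow>
     (\<forall>p q. \<forall>i\<in>C p. \<forall>i'\<in>C p. (\<Sum>j\<in>C q. A $ i $ j) = (\<Sum>j\<in>C q. A $ i' $ j))"

text \<open>Only meaningful under \<open>common_influence C A\<close>, where the choice of the row does not matter.\<close>

definition inter_cluster_matrix :: "('k \<Rightarrow> 'n set) \<Rightarrow> real ^ 'n ^ 'n \<Rightarrow> real ^ 'k ^ 'k" where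
  "inter_cluster_matrix C A = (\<chi> p q. \<Sum>j\<in>C q. A $ (SOME i. i \<in> C p) $ j)"

definition admissible_matrices :: "('k \<Rightarrow> 'n::finite set) \<Rightarrow> ('n \<times> 'n) set \<Rightarrow> (real ^ 'k ^ 'k) set" where
  "admissible_matrices C G =
     {B. \<exists>A. stochastic A \<and> matrix_graph A = G \<and> common_influence C A \<and>
             B = inter_cluster_matrix C A}"

text \<open>
  The vector \<open>[u\<^sub>1, \<dots>, u\<^sub>T\<^sub>-\<^sub>1]\<close> is an (extensional) function on the index set \<open>{1..<T}\<close>, so that
  \<open>\<real>\<^sup>T\<^sup>-\<^sup>1\<close> with Lebesgue measure is the product space \<open>PiM {1..<T} (\<lambda>_. lborel)\<close>.
\<close>

definition triples ::
    "nat \<Rightarrow> ('k \<Rightarrow> 'n::finite set) \<Rightarrow> ('n \<times> 'n) set \<Rightarrow>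
      ((real ^ 'k ^ 'k) \<times> (real ^ 'k) \<times> (nat \<Rightarrow> real)) set" where
  "triples T C G = admissible_matrices C G \<times> UNIV \<times> ({1..<T} \<rightarrow>\<^sub>E UNIV)"

definition orthonormal_basis_of :: "'a::euclidean_space set \<Rightarrow> 'a set \<Rightarrow> bool" where
  "orthonormal_basis_of V E \<longleftrightarrow> pairwise orthogonal E \<and> (\<forall>e\<in>E. norm e = 1) \<and> span E = V"

text \<open>
  Lebesgue measure on a nonempty affine subspace \<open>S\<close>, as a Borel measure on the ambient space: the
  image of the product Lebesgue measure under Cartesian coordinates of \<open>S\<close>, i.e. coordinates with
  respect to an origin in \<open>S\<close> and an orthonormal basis of the direction space of \<open>S\<close>. By invariance
  of Lebesgue measure under isometries it does not depend on these two choices.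
\<close>

definition lborel_affine :: "'a::euclidean_space set \<Rightarrow> 'a measure" where
  "lborel_affine S =
     (let a = (SOME a. a \<in> S);
          E = (SOME E. orthonormal_basis_of ((\<lambda>x. x - a) ` S) E)
      in distr (\<Pi>\<^sub>M e\<in>E. lborel) borel (\<lambda>c. a + (\<Sum>e\<in>E. c e *\<^sub>R e)))"

lemma orthonormal_basis_of_exists:
  fixes S :: "'a::euclidean_space set"
  assumes "affine S" "a \<in> S"
  shows "\<exists>E. orthonormal_basis_of ((\<lambda>x. x - a) ` S) E"
proof -
  have "subspace ((\<lambda>x. x - a) ` S)"
    using affine_diffs_subspace_subtract[OF assms] .
  then show ?thesis
    unfolding orthonormal_basis_of_def by (metis orthonormal_basis_subspace)
qed

lemma orthonormal_basis_of_finite: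
  fixes E :: "'a::euclidean_space set"
  assumes "orthonormal_basis_of V E"
  shows "finite E"
  using assms unfolding orthonormal_basis_of_def by (simp add: pairwise_orthogonal_imp_finite)

lemma measurable_affine_coordinates:
  fixes a :: "'a::euclidean_space"
  shows "(\<lambda>c. a + (\<Sum>e\<in>E. c e *\<^sub>R e)) \<in> borel_measurable (\<Pi>\<^sub>M e\<in>E. lborel)"
  by measurable

definition triple_measure ::
    "nat \<Rightarrow> ('k::finite \<Rightarrow> 'n::finite set) \<Rightarrow> ('n \<times> 'n) set \<Rightarrow>
      ((real ^ 'k ^ 'k) \<times> (real ^ 'k) \<times> (nat \<Rightarrow> real)) measure" where
  "triple_measure T C G =
     lborel_affine (affine hull (admissible_matrices C G)) \<Otimes>\<^sub>M
       (lborel \<Otimes>\<^sub>M (\<Pi>\<^sub>M \<theta>\<in>{1..<T}. lborel))"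

definition cluster_vector :: "('k \<Rightarrow> 'n set) \<Rightarrow> real ^ 'k \<Rightarrow> real ^ 'n" where
  "cluster_vector C \<alpha> = (\<chi> i. \<alpha> $ (THE p. i \<in> C p))"

definition periodic_input :: "nat \<Rightarrow> (nat \<Rightarrow> real) \<Rightarrow> nat \<Rightarrow> real" where
  "periodic_input T u t =
     (if t mod T = 0 then - (\<Sum>j\<in>{1..<T}. u j) else u (t mod T))"

primrec trajectory ::
    "real ^ 'n ^ 'n \<Rightarrow> real ^ 'n \<Rightarrow> (nat \<Rightarrow> real) \<Rightarrow> real ^ 'n \<Rightarrow> nat \<Rightarrow> real ^ 'n" where
  "trajectory A s w x0 0 = x0"
| "trajectory A s w x0 (Suc t) = A *v trajectory A s w x0 t + w t *\<^sub>R s"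

definition intra_cluster_synchronizes :: "('k \<Rightarrow> 'n set) \<Rightarrow> (nat \<Rightarrow> real ^ 'n) \<Rightarrow> bool" where
  "intra_cluster_synchronizes C x \<longleftrightarrow>
     (\<forall>p. \<forall>i\<in>C p. \<forall>i'\<in>C p. (\<lambda>t. \<bar>x t $ i - x t $ i'\<bar>) \<longlonglongrightarrow> 0)"

definition inter_cluster_separates :: "('k \<Rightarrow> 'n set) \<Rightarrow> (nat \<Rightarrow> real ^ 'n) \<Rightarrow> bool" where
  "inter_cluster_separates C x \<longleftrightarrow>
     (\<forall>k l. k \<noteq> l \<longrightarrow>
        (\<forall>i\<in>C k. \<forall>j\<in>C l. limsup (\<lambda>t. ereal \<bar>x t $ i - x t $ j\<bar>) > 0))"

definition cluster_consensus :: "('k \<Rightarrow> 'n::finite set) \<Rightarrow> (nat \<Rightarrow> real ^ 'n) \<Rightarrow> bool" where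
  "cluster_consensus C x \<longleftrightarrow>
     bounded (range x) \<and> intra_cluster_synchronizes C x \<and> inter_cluster_separates C x"

end

theory Submission
  imports Defs
begin

text \<open>
  A stochastic matrix \<open>A\<close> with positive diagonal has convergent powers, hence \<open>I - A\<close> and
  \<open>I - A\<^sup>T\<close> have the same range. As the input has zero mean, the equation for a \<open>T\<close>-periodic solution is
  \<open>(I - A\<^sup>T) p = q\<close> with \<open>q\<close> in that range, so every trajectory approaches a periodic one. A periodic
  solution attains its largest intra-cluster spread, and common ancestors in the graph force this
  spread to vanish.

  Separation holds for every \<open>B\<close>, every \<open>u\<close> with \<open>u\<^sub>1 \<noteq> 0\<close>, almost every \<open>\<alpha>\<close> and every \<open>x(0)\<close>: if the
  clusters \<open>k\<close> and \<open>l\<close> do not separate, then the increments of \<open>y\<^sub>k - y\<^sub>l\<close> tend to \<open>0\<close> for the solution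
  \<open>y\<close> of \<open>y(t + 1) = B y(t) + u(t) \<alpha>\<close> starting at \<open>0\<close>, and the \<open>\<alpha>\<close> with this property form a proper
  subspace.
\<close>

section \<open>Stochastic matrices: the sup norm and convergence of powers\<close>

lemma infnorm_attained:
  fixes x :: "real ^ 'm"
  obtains i where "infnorm x = \<bar>x $ i\<bar>"
proof -
  have "infnorm x \<in> (\<lambda>b. \<bar>x \<bullet> b\<bar>) ` Basis"
    unfolding infnorm_Max by (rule Max_in) auto
  then show ?thesis
    by (auto simp: Basis_vec_def inner_axis intro: that)
qed

lemma infnorm_le_iff:
  fixes x :: "real ^ 'm"
  shows "infnorm x \<le> c \<longleftrightarrow> (\<forall>i. \<bar>x $ i\<bar> \<le> c)"
  by (metis component_le_infnorm_cart infnorm_attained order_trans)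

lemma infnorm_stochastic_le:
  assumes "stochastic A"
  shows "infnorm (A *v x) \<le> infnorm x"
  unfolding infnorm_le_iff
proof
  fix i
  have "\<bar>(A *v x) $ i\<bar> \<le> (\<Sum>j\<in>UNIV. A $ i $ j * \<bar>x $ j\<bar>)"
    unfolding matrix_vector_mult_def using assms
    by (auto simp: stochastic_def abs_mult intro!: order_trans[OF sum_abs] sum_mono)
  also have "\<dots> \<le> (\<Sum>j\<in>UNIV. A $ i $ j * infnorm x)"
    using assms by (intro sum_mono mult_left_mono) (auto simp: stochastic_def component_le_infnorm_cart)
  also have "\<dots> = infnorm x"
    using assms by (simp add: stochastic_def flip: sum_distrib_right)
  finally show "\<bar>(A *v x) $ i\<bar> \<le> infnorm x" .
qed

lemma linear_matrix_vector_funpow: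
  fixes A :: "real ^ 'm ^ 'm"
  shows "linear ((*v) A ^^ t)"
  by (induction t) (auto intro: linear_compose[unfolded o_def] simp: linear_id[unfolded id_def] o_def)

lemma infnorm_stochastic_funpow_decseq:
  assumes "stochastic A"
  shows "decseq (\<lambda>t. infnorm (((*v) A ^^ t) x))"
  by (rule decseq_SucI) (simp add: infnorm_stochastic_le[OF assms])

text \<open>The deficits \<open>M - v $ j\<close> are nonnegative and their average with the weights
  of row \<open>i\<close> is \<open>0\<close>, so every deficit of positive weight vanishes.\<close>

lemma stochastic_extremal_coordinate:
  assumes "stochastic A" "\<And>j. v $ j \<le> M" "(A *v v) $ i = M" "A $ i $ j > 0"
  shows "v $ j = M"
proof -
  have "(\<Sum>j\<in>UNIV. A $ i $ j * (M - v $ j)) = (\<Sum>j\<in>UNIV. A $ i $ j) * M - (A *v v) $ i"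
    by (simp add: matrix_vector_mult_def right_diff_distrib sum_subtractf sum_distrib_right)
  also have "\<dots> = 0"
    using assms by (simp add: stochastic_def)
  finally have "\<forall>j\<in>UNIV. A $ i $ j * (M - v $ j) = 0"
    using assms by (subst (asm) sum_nonneg_eq_0_iff) (auto simp: stochastic_def)
  then show ?thesis
    using assms(4) by (metis UNIV_I eq_iff_diff_eq_0 less_irrefl mult_eq_0_iff)
qed

text \<open>
  An extremal coordinate of \<open>A\<^sup>n e\<close> is extremal, with the same sign, in every earlier iterate, so
  that the telescoping sum of the \<open>A\<^sup>s e\<close> would grow linearly.
\<close>

lemma stochastic_infnorm_constant_imp_fixed:
  fixes A :: "real ^ 'm ^ 'm"
  assumes A: "stochastic A" and diag: "\<And>i. A $ i $ i > 0"
    and const: "\<And>s. infnorm (((*v) A ^^ s) (z - A *v z)) = M"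
  shows "A *v z = z"
proof -
  define e where "e = z - A *v z"
  have const': "infnorm (((*v) A ^^ s) e) = M" for s
    using const by (simp add: e_def)
  have neg: "((*v) A ^^ s) (- e) = - ((*v) A ^^ s) e" for s
    by (rule linear_neg[OF linear_matrix_vector_funpow])
  have backward: "(((*v) A ^^ s) v) $ i = M"
    if "s \<le> n" "(((*v) A ^^ n) v) $ i = M" "\<And>s. infnorm (((*v) A ^^ s) v) = M" for s n v i
    using that(1)
  proof (induction s rule: inc_induct)
    case (step s)
    show ?case
    proof (rule stochastic_extremal_coordinate[OF A _ _ diag])
      show "(((*v) A ^^ s) v) $ j \<le> M" for j
        using component_le_infnorm_cart[of "((*v) A ^^ s) v" j] that(3)[of s] by linarith
    qed (use step in simp)
  qed (use that in simp)
  have tele: "(\<Sum>s<n. ((*v) A ^^ s) e) = z - ((*v) A ^^ n) z" for n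
  proof (induction n)
    case (Suc n)
    have "((*v) A ^^ n) e = ((*v) A ^^ n) z - ((*v) A ^^ n) (A *v z)"
      unfolding e_def by (rule linear_diff[OF linear_matrix_vector_funpow])
    then show ?case using Suc by (simp add: funpow_swap1)
  qed simp
  \<comment> \<open>The coordinate \<open>i\<close> attaining the norm may change with
    \<open>n\<close>, but the bound \<open>2 * infnorm z\<close> does not.\<close>
  have bound: "real n * M \<le> 2 * infnorm z" for n
  proof -
    obtain i where i: "M = \<bar>(((*v) A ^^ n) e) $ i\<bar>"
      using infnorm_attained const' by metis
    have "\<bar>\<Sum>s<n. (((*v) A ^^ s) e) $ i\<bar> = real n * M"
    proof (cases "(((*v) A ^^ n) e) $ i \<ge> 0")
      case True
      then have "(((*v) A ^^ s) e) $ i = M" if "s < n" for s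
        using backward[of s n e i] that i const' by simp
      then show ?thesis using i by (simp add: abs_mult)
    next
      case False
      then have "(((*v) A ^^ s) (- e)) $ i = M" if "s < n" for s
        using backward[of s n "- e" i] that i const' by (simp add: neg infnorm_neg)
      then have "(((*v) A ^^ s) e) $ i = - M" if "s < n" for s
        using that by (simp add: neg minus_equation_iff)
      then show ?thesis using i by (simp add: abs_mult)
    qed
    moreover have "(\<Sum>s<n. (((*v) A ^^ s) e) $ i) = z $ i - (((*v) A ^^ n) z) $ i"
      using arg_cong[OF tele[of n], of "\<lambda>v. v $ i"] by simp
    moreover have "\<bar>z $ i - (((*v) A ^^ n) z) $ i\<bar> \<le> infnorm z + infnorm (((*v) A ^^ n) z)"
      using component_le_infnorm_cart[of z i] component_le_infnorm_cart[of "((*v) A ^^ n) z" i]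
      by linarith
    moreover have "infnorm (((*v) A ^^ n) z) \<le> infnorm z"
      using decseqD[OF infnorm_stochastic_funpow_decseq[OF A], of 0 n z] by simp
    ultimately show ?thesis by simp
  qed
  have "M \<le> 0"
  proof (rule ccontr)
    assume "\<not> M \<le> 0"
    then obtain n where "2 * infnorm z < real n * M"
      by (meson not_le reals_Archimedean3)
    with bound[of n] show False by simp
  qed
  then have "infnorm e = 0"
    using const'[of 0] infnorm_pos_le[of e] by simp
  then show ?thesis
    by (simp add: infnorm_eq_0 e_def)
qed

text \<open>The orbit is bounded and has a limit point \<open>z\<close>. The norms of the powers
  applied to \<open>y - A *v y\<close> decrease to a limit, and by continuity every power applied to
  \<open>z - A *v z\<close> has exactly this norm, so \<open>z\<close> is fixed.\<close>

lemma stochastic_funpow_convergent: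
  fixes A :: "real ^ 'm ^ 'm"
  assumes A: "stochastic A" and diag: "\<And>i. A $ i $ i > 0"
  obtains L where "A *v L = L" "(\<lambda>t. ((*v) A ^^ t) y) \<longlonglongrightarrow> L"
proof -
  let ?y = "\<lambda>t. ((*v) A ^^ t) y"
  have "bounded (range ?y)"
    unfolding bounded_iff
  proof (intro exI ballI)
    fix v assume "v \<in> range ?y"
    then obtain t where "v = ?y t" by auto
    then have "infnorm v \<le> infnorm y"
      using decseqD[OF infnorm_stochastic_funpow_decseq[OF A], of 0 t y] by simp
    then show "norm v \<le> sqrt DIM(real ^ 'm) * infnorm y"
      by (meson mult_left_mono norm_le_infnorm of_nat_0_le_iff order_trans real_sqrt_ge_zero)
  qed
  then obtain z r where r: "strict_mono r" and z: "(?y \<circ> r) \<longlonglongrightarrow> z"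
    using bounded_imp_convergent_subsequence by blast
  let ?d = "\<lambda>t. infnorm (((*v) A ^^ t) (y - A *v y))"
  have "bdd_below (range ?d)"
    by (rule bdd_belowI[of _ 0]) (auto simp: infnorm_pos_le)
  then have d: "?d \<longlonglongrightarrow> Inf (range ?d)"
    by (rule LIMSEQ_decseq_INF[OF _ infnorm_stochastic_funpow_decseq[OF A]])
  have "infnorm (((*v) A ^^ s) (z - A *v z)) = Inf (range ?d)" for s
  proof (rule LIMSEQ_unique)
    have lin: "linear (\<lambda>v. ((*v) A ^^ s) (v - A *v v))"
      by (rule linear_compose[OF _ linear_matrix_vector_funpow, unfolded o_def])
         (intro linear_compose_sub matrix_vector_mul_linear linear_ident)
    have "(\<lambda>k. infnorm (((*v) A ^^ s) (?y (r k) - A *v ?y (r k))))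
        \<longlonglongrightarrow> infnorm (((*v) A ^^ s) (z - A *v z))"
      using tendsto_infnorm[OF bounded_linear.tendsto[OF lin[unfolded linear_conv_bounded_linear] z]]
      by (simp add: o_def)
    moreover have "((*v) A ^^ s) (?y t - A *v ?y t) = ((*v) A ^^ (s + t)) (y - A *v y)" for t
      by (simp add: funpow_add linear_diff[OF linear_matrix_vector_funpow] funpow_swap1)
    ultimately show "(\<lambda>k. ?d (s + r k)) \<longlonglongrightarrow> infnorm (((*v) A ^^ s) (z - A *v z))"
      by simp
    have "strict_mono (\<lambda>k. s + r k)"
      using r by (simp add: strict_mono_def)
    then show "(\<lambda>k. ?d (s + r k)) \<longlonglongrightarrow> Inf (range ?d)"
      using LIMSEQ_subseq_LIMSEQ[OF d] by (simp add: o_def)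
  qed
  then have fixed: "A *v z = z"
    by (rule stochastic_infnorm_constant_imp_fixed[OF A diag])
  have diff: "((*v) A ^^ t) (y - z) = ?y t - z" for t
  proof -
    have "((*v) A ^^ t) z = z" by (induction t) (simp_all add: fixed)
    then show ?thesis by (simp add: linear_diff[OF linear_matrix_vector_funpow])
  qed
  \<comment> \<open>The distance of the orbit to the fixed vector \<open>z\<close> also decreases;
    it tends to \<open>0\<close> along \<open>r\<close>, hence along all times.\<close>
  let ?e = "\<lambda>t. infnorm (((*v) A ^^ t) (y - z))"
  have "bdd_below (range ?e)"
    by (rule bdd_belowI[of _ 0]) (auto simp: infnorm_pos_le)
  then have e: "?e \<longlonglongrightarrow> Inf (range ?e)"
    by (rule LIMSEQ_decseq_INF[OF _ infnorm_stochastic_funpow_decseq[OF A]])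
  have "(\<lambda>k. ?e (r k)) \<longlonglongrightarrow> 0"
    using tendsto_infnorm[OF tendsto_diff[OF z tendsto_const[of z]]]
    by (simp add: diff o_def infnorm_0)
  moreover have "(\<lambda>k. ?e (r k)) \<longlonglongrightarrow> Inf (range ?e)"
    using LIMSEQ_subseq_LIMSEQ[OF e r] by (simp add: o_def)
  ultimately have "Inf (range ?e) = 0"
    using LIMSEQ_unique by blast
  then have "(\<lambda>t. sqrt DIM(real ^ 'm) * ?e t) \<longlonglongrightarrow> 0"
    using tendsto_mult_left[OF e, of "sqrt DIM(real ^ 'm)"] by simp
  then have "(\<lambda>t. ?y t - z) \<longlonglongrightarrow> 0"
    by (rule Lim_null_comparison[rotated])
       (intro always_eventually allI, unfold diff[symmetric], rule norm_le_infnorm)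
  then have "?y \<longlonglongrightarrow> z"
    by (simp add: LIM_zero_iff)
  with fixed show thesis by (rule that)
qed

section \<open>Periodic solutions under a zero-mean periodic input\<close>

lemma trajectory_diff:
  fixes A :: "real ^ 'm ^ 'm"
  shows "trajectory A s w x t - trajectory A s w y t = ((*v) A ^^ t) (x - y)"
  by (induction t) (simp_all flip: matrix_vector_mult_diff_distrib)

lemma trajectory_shift:
  "trajectory A s w x (t + t') = trajectory A s (\<lambda>i. w (i + t')) (trajectory A s w x t') t"
  by (induction t) (simp_all)

text \<open>Modulo the range of \<open>I - A\<close> the matrix acts as the identity, so the inputs
  simply add up. If they sum to \<open>0\<close>, only an element of that range remains.\<close>

lemma trajectory_zero_decomposition:
  fixes A :: "real ^ 'm ^ 'm"
  shows "\<exists>r. trajectory A s w 0 t = (\<Sum>i<t. w i) *\<^sub>R s + (r - A *v r)"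
proof (induction t)
  case (Suc t)
  then obtain r where r: "trajectory A s w 0 t = (\<Sum>i<t. w i) *\<^sub>R s + (r - A *v r)"
    by blast
  let ?y = "trajectory A s w 0 t"
  \<comment> \<open>Since \<open>A *v ?y\<close> is \<open>?y - (?y - A *v ?y)\<close>, the new
    witness is \<open>r - ?y\<close>.\<close>
  have "trajectory A s w 0 (Suc t) = (\<Sum>i<Suc t. w i) *\<^sub>R s + ((r - ?y) - A *v (r - ?y))"
    by (simp add: r algebra_simps matrix_vector_mult_diff_distrib)
  then show ?case by blast
qed (auto intro: exI[of _ 0])

text \<open>The map \<open>g\<close>, which is \<open>I - A\<^sup>T\<close>, sends the range
  \<open>R\<close> of \<open>I - A\<close> into itself. It is injective there: a vector of
  \<open>R\<close> in its kernel recurs every \<open>T\<close> steps, while the powers of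
  \<open>A\<close> applied to \<open>z - A *v z\<close> tend to \<open>0\<close>. Finite dimension
  then makes it onto \<open>R\<close>.\<close>

lemma stochastic_period_equation:
  fixes A :: "real ^ 'm ^ 'm"
  assumes A: "stochastic A" and diag: "\<And>i. A $ i $ i > 0" and T: "T > 0"
  shows "\<exists>p. p - ((*v) A ^^ T) p = r - A *v r"
proof -
  define R where "R = range (\<lambda>x. x - A *v x)"
  define g where "g = (\<lambda>x. x - ((*v) A ^^ T) x)"
  have "linear (\<lambda>x. x - A *v x)"
    by (intro linear_compose_sub matrix_vector_mul_linear linear_ident)
  then have sub: "subspace R"
    unfolding R_def by (metis linear_subspace_image subspace_UNIV)
  have g: "linear g"
    unfolding g_def by (intro linear_compose_sub linear_matrix_vector_funpow linear_ident)
  have gR: "g ` R \<subseteq> R"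
  proof
    fix v assume "v \<in> g ` R"
    then obtain z where "v = g (z - A *v z)" by (auto simp: R_def)
    then have "v = g z - A *v g z"
      by (simp add: g_def linear_diff[OF linear_matrix_vector_funpow] funpow_swap1
          matrix_vector_mult_diff_distrib)
    then show "v \<in> R" by (auto simp: R_def)
  qed
  have "x = 0" if "x \<in> R" "g x = 0" for x
  proof -
    from that(1) obtain z where z: "x = z - A *v z" unfolding R_def by blast
    obtain L where L: "A *v L = L" "(\<lambda>t. ((*v) A ^^ t) z) \<longlonglongrightarrow> L"
      by (rule stochastic_funpow_convergent[OF A diag])
    have "(\<lambda>t. ((*v) A ^^ t) x) \<longlonglongrightarrow> L - L"
      unfolding z linear_diff[OF linear_matrix_vector_funpow]
      using tendsto_diff[OF L(2) LIMSEQ_Suc[OF L(2)]] by (simp add: funpow_swap1)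
    moreover have "strict_mono (\<lambda>k. T * k)"
      using T by (simp add: strict_mono_def)
    ultimately have "(\<lambda>k. ((*v) A ^^ (T * k)) x) \<longlonglongrightarrow> 0"
      using LIMSEQ_subseq_LIMSEQ by (fastforce simp: o_def)
    moreover have "((*v) A ^^ (T * k)) x = x" for k
      using that by (induction k) (simp_all add: g_def funpow_add)
    ultimately show "x = 0" by (simp add: LIMSEQ_const_iff)
  qed
  then have "inj_on g R"
    using linear_inj_on_iff_eq_0[OF g sub] by blast
  then have "dim (g ` R) = dim R"
    using dim_image_eq[OF g] sub by (metis span_eq_iff)
  then have "g ` R = R"
    by (intro subspace_dim_equal linear_subspace_image g sub gR) simp
  show ?thesis
  proof -
    have "r - A *v r \<in> g ` R"
      using \<open>g ` R = R\<close> by (simp add: R_def)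
    then show ?thesis
      unfolding g_def by force
  qed
qed

text \<open>The equation for \<open>p\<close> says that the trajectory from \<open>p\<close> returns
  after \<open>T\<close> steps. Its difference to the trajectory from \<open>x\<close> tends to a
  fixed vector \<open>L\<close> of \<open>A\<close>; starting from \<open>p + L\<close> keeps the
  period and removes this limit.\<close>

lemma stochastic_periodic_trajectory:
  fixes A :: "real ^ 'm ^ 'm"
  assumes A: "stochastic A" and diag: "\<And>i. A $ i $ i > 0" and T: "T > 0"
    and w: "\<And>t. w (t + T) = w t" "(\<Sum>i<T. w i) = 0"
  obtains V where "\<And>t. trajectory A s w V (t + T) = trajectory A s w V t"
    "(\<lambda>t. trajectory A s w x t - trajectory A s w V t) \<longlonglongrightarrow> 0"
proof -
  obtain r where r: "trajectory A s w 0 T = r - A *v r"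
    using trajectory_zero_decomposition[of A s w T] w(2) by auto
  obtain p where p: "p - ((*v) A ^^ T) p = r - A *v r"
    using stochastic_period_equation[OF A diag T] by blast
  obtain L where L: "A *v L = L" "(\<lambda>t. ((*v) A ^^ t) (x - p)) \<longlonglongrightarrow> L"
    by (rule stochastic_funpow_convergent[OF A diag])
  have fixL: "((*v) A ^^ t) L = L" for t
    by (induction t) (simp_all add: L)
  show thesis
  proof (rule that[of "p + L"])
    have "trajectory A s w (p + L) T = ((*v) A ^^ T) (p + L) + trajectory A s w 0 T"
      using trajectory_diff[of A s w "p + L" T 0] by (simp add: algebra_simps)
    also have "\<dots> = p + L"
      using p by (simp add: r linear_add[OF linear_matrix_vector_funpow] fixL algebra_simps)
    finally show "trajectory A s w (p + L) (t + T) = trajectory A s w (p + L) t" for t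
      unfolding trajectory_shift by (simp add: w(1))
    have "trajectory A s w x t - trajectory A s w (p + L) t = ((*v) A ^^ t) (x - p) - L" for t
      by (simp add: trajectory_diff fixL linear_diff[OF linear_matrix_vector_funpow]
          flip: diff_diff_eq)
    then show "(\<lambda>t. trajectory A s w x t - trajectory A s w (p + L) t) \<longlonglongrightarrow> 0"
      using L(2) by (simp add: LIM_zero)
  qed
qed

section \<open>Vectors constant on clusters\<close>

lemma clustering_the_eq:
  assumes "clustering C" "i \<in> C p"
  shows "(THE q. i \<in> C q) = p"
proof (rule the_equality)
  fix q assume "i \<in> C q"
  with assms show "q = p"
    unfolding clustering_def by (metis disjointD inj_eq partition_onD2 rangeI disjoint_iff)
qed fact

lemma clustering_covers:
  assumes "clustering C"
  obtains p where "i \<in> C p"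
  using assms partition_onD1 unfolding clustering_def by blast

lemma clustering_nonempty:
  assumes "clustering C"
  shows "C p \<noteq> {}"
  using assms partition_onD3 unfolding clustering_def by (metis rangeI)

lemma cluster_vector_nth:
  assumes "clustering C" "i \<in> C p"
  shows "cluster_vector C \<alpha> $ i = \<alpha> $ p"
  by (simp add: cluster_vector_def clustering_the_eq[OF assms])

lemma cluster_vector_eq_iff:
  assumes "clustering C"
  shows "x = cluster_vector C a \<longleftrightarrow> (\<forall>p. \<forall>i\<in>C p. x $ i = a $ p)"
  unfolding vec_eq_iff by (metis assms cluster_vector_nth clustering_covers)

text \<open>The sum along a row splits over the clusters, and on \<open>C q\<close> the factor
  \<open>a $ q\<close> comes out, leaving an entry of the inter-cluster matrix. This reduces
  cluster-constant dynamics to that matrix.\<close>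

lemma common_influence_cluster_vector:
  fixes A :: "real ^ 'n ^ 'n" and C :: "'k::finite \<Rightarrow> 'n set"
  assumes C: "clustering C" and A: "common_influence C A"
  shows "A *v cluster_vector C a = cluster_vector C (inter_cluster_matrix C A *v a)"
  unfolding cluster_vector_eq_iff[OF C]
proof (intro allI ballI)
  fix p i assume i: "i \<in> C p"
  then have "(SOME j. j \<in> C p) \<in> C p"
    by (rule someI)
  then have row: "(\<Sum>j\<in>C q. A $ i $ j) = inter_cluster_matrix C A $ p $ q" for q
    using A i unfolding common_influence_def inter_cluster_matrix_def vec_lambda_beta by blast
  have disjoint: "C q \<inter> C q' = {}" if "q \<noteq> q'" for q q'
    using clustering_the_eq[OF C] that by (metis disjoint_iff)
  have "UNIV = (\<Union>q. C q)"
    using clustering_covers[OF C] by blast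
  then have "(A *v cluster_vector C a) $ i = (\<Sum>j\<in>(\<Union>q. C q). A $ i $ j * cluster_vector C a $ j)"
    by (simp add: matrix_vector_mult_def)
  also have "\<dots> = (\<Sum>q\<in>UNIV. \<Sum>j\<in>C q. A $ i $ j * cluster_vector C a $ j)"
    by (rule sum.UNION_disjoint) (use disjoint in auto)
  also have "\<dots> = (\<Sum>q\<in>UNIV. (\<Sum>j\<in>C q. A $ i $ j) * a $ q)"
    by (simp add: cluster_vector_nth[OF C] sum_distrib_right)
  also have "\<dots> = (inter_cluster_matrix C A *v a) $ p"
    by (simp add: row matrix_vector_mult_def)
  finally show "(A *v cluster_vector C a) $ i = (inter_cluster_matrix C A *v a) $ p" .
qed

lemma trajectory_cluster_vector:
  assumes C: "clustering C" and A: "common_influence C A"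
  shows "trajectory A (cluster_vector C \<alpha>) w (cluster_vector C a) t =
    cluster_vector C (trajectory (inter_cluster_matrix C A) \<alpha> w a t)"
proof (induction t)
  case (Suc t)
  show ?case
    by (simp only: trajectory.simps Suc common_influence_cluster_vector[OF assms])
       (simp add: cluster_vector_def vec_eq_iff)
qed simp

section \<open>Spread inside clusters\<close>

lemma stochastic_le:
  assumes "stochastic A" "\<And>j. v $ j \<le> M"
  shows "(A *v v) $ i \<le> M"
proof -
  have "(A *v v) $ i \<le> (\<Sum>j\<in>UNIV. A $ i $ j * M)"
    unfolding matrix_vector_mult_def using assms
    by (auto simp: stochastic_def intro!: sum_mono mult_left_mono)
  also have "\<dots> = M"
    using assms by (simp add: stochastic_def flip: sum_distrib_right)
  finally show ?thesis .
qed

text \<open>Both orders of a pair are covered, so \<open>D\<close> bounds absolute differences as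
  well and the predicate passes to \<open>- y\<close>.\<close>

definition cluster_spread_le :: "('k \<Rightarrow> 'n set) \<Rightarrow> real ^ 'n \<Rightarrow> real \<Rightarrow> bool" where
  "cluster_spread_le C y D \<longleftrightarrow> (\<forall>q. \<forall>i\<in>C q. \<forall>j\<in>C q. y $ i - y $ j \<le> D)"

lemma cluster_spread_leD:
  "cluster_spread_le C y D \<Longrightarrow> i \<in> C q \<Longrightarrow> j \<in> C q \<Longrightarrow> y $ i - y $ j \<le> D"
  unfolding cluster_spread_le_def by blast

text \<open>Subtracting the vector of cluster minima does not change the difference of the
  coordinates \<open>i\<close> and \<open>i'\<close> of \<open>A *v y\<close>, because
  \<open>A\<close> maps that vector to a cluster-constant one. Row \<open>i'\<close> then averages
  nonnegative entries and row \<open>i\<close> entries at most \<open>D\<close>. A difference of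
  \<open>D\<close> makes row \<open>i\<close> extremal, so \<open>y $ j\<close> lies
  \<open>D\<close> above the minimum of its cluster.\<close>

lemma cluster_spread_attained_step:
  fixes A :: "real ^ 'n ^ 'n" and C :: "'k::finite \<Rightarrow> 'n set"
  assumes C: "clustering C" and A: "stochastic A" "common_influence C A"
    and spread: "cluster_spread_le C y D"
    and i: "i \<in> C p" "i' \<in> C p" "(A *v y) $ i - (A *v y) $ i' = D"
    and j: "A $ i $ j > 0" "j \<in> C q"
  shows "\<exists>j'\<in>C q. y $ j - y $ j' = D"
proof -
  define l :: "real ^ 'k" where "l = (\<chi> q. Min (($) y ` C q))"
  let ?l = "cluster_vector C l"
  have l_le: "?l $ j \<le> y $ j" for j
  proof -
    obtain q where "j \<in> C q" using clustering_covers[OF C] .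
    then show ?thesis by (simp add: cluster_vector_nth[OF C] l_def)
  qed
  have l_attained: "\<exists>j'\<in>C q. l $ q = y $ j'" for q
  proof -
    have "Min (($) y ` C q) \<in> ($) y ` C q"
      using clustering_nonempty[OF C] by (intro Min_in) auto
    then show ?thesis by (auto simp: l_def)
  qed
  have ub: "(y - ?l) $ j \<le> D" for j
  proof -
    obtain q where q: "j \<in> C q" using clustering_covers[OF C] .
    with l_attained[of q] cluster_spread_leD[OF spread q] show ?thesis
      by (auto simp: cluster_vector_nth[OF C q])
  qed
  have "(A *v ?l) $ i = (A *v ?l) $ i'"
    by (simp add: common_influence_cluster_vector[OF C A(2)] cluster_vector_nth[OF C i(1)]
        cluster_vector_nth[OF C i(2)])
  moreover have "(A *v (?l - y)) $ i' \<le> 0"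
    using l_le by (intro stochastic_le[OF A(1)]) simp
  moreover have "(A *v (y - ?l)) $ i \<le> D"
    using ub by (rule stochastic_le[OF A(1)])
  ultimately have "(A *v (y - ?l)) $ i = D"
    using i(3) by (simp add: matrix_vector_mult_diff_distrib)
  then have "(y - ?l) $ j = D"
    using stochastic_extremal_coordinate[OF A(1) ub] j(1) by blast
  then show ?thesis
    using l_attained[of q] by (auto simp: cluster_vector_nth[OF C j(2)])
qed

text \<open>The one-step lemma is iterated backwards along the path. Only the upper vertex follows
  the path; its partner is chosen anew in each cluster. The cluster-constant input cancels in every
  difference.\<close>

lemma cluster_spread_attained_ancestor:
  fixes A :: "real ^ 'n ^ 'n" and C :: "'k::finite \<Rightarrow> 'n set"
  assumes C: "clustering C" and A: "stochastic A" "common_influence C A"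
    and rec: "\<And>t. V (Suc t) = A *v V t + cluster_vector C (b t)"
    and spread: "\<And>t. cluster_spread_le C (V t) D"
    and i: "i \<in> C p" "i' \<in> C p" "V (t + m) $ i - V (t + m) $ i' = D"
    and j: "(j, i) \<in> matrix_graph A ^^ m"
  shows "\<exists>q. \<exists>j'\<in>C q. j \<in> C q \<and> V t $ j - V t $ j' = D"
  using i j
proof (induction m arbitrary: i i' p)
  case (Suc m)
  from Suc.prems(4) obtain k where k: "(j, k) \<in> matrix_graph A ^^ m" "A $ i $ k > 0"
    by (auto simp: matrix_graph_def)
  obtain q where q: "k \<in> C q" using clustering_covers[OF C] .
  have "(A *v V (t + m)) $ i - (A *v V (t + m)) $ i' = D"
    using Suc.prems by (simp add: rec cluster_vector_nth[OF C])
  from cluster_spread_attained_step[OF C A spread Suc.prems(1,2) this k(2) q]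
  obtain k' where "k' \<in> C q" "V (t + m) $ k - V (t + m) $ k' = D"
    by blast
  from Suc.IH[OF q this k(1)] show ?case .
qed auto

text \<open>Self-links pad a path, so that two paths from a common ancestor can be given the same
  length.\<close>

lemma relpow_mono_reflexive:
  assumes "\<And>i. (i, i) \<in> G" "(v, w) \<in> G ^^ a" "a \<le> m"
  shows "(v, w) \<in> G ^^ m"
  using assms(3) by (induction rule: dec_induct) (auto intro: assms)

text \<open>
  If the largest spread \<open>D\<close> is attained by \<open>i\<close> over \<open>i'\<close> at some time, then a common ancestor of
  \<open>i\<close> and \<open>i'\<close> is at an earlier time both \<open>D\<close> above and \<open>D\<close> below members of its own cluster;
  these differ by \<open>2 D\<close>, so \<open>D \<le> 0\<close>.
\<close>

lemma periodic_solution_cluster_constant: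
  fixes A :: "real ^ 'n ^ 'n" and C :: "'k::finite \<Rightarrow> 'n set"
  assumes C: "clustering C" and A: "stochastic A" "common_influence C A"
    and diag: "\<And>i. A $ i $ i > 0"
    and trees: "cluster_spanning_trees C (matrix_graph A)"
    and rec: "\<And>t. V (Suc t) = A *v V t + cluster_vector C (b t)"
    and per: "\<And>t. V (t + T) = V t" and T: "T > 0"
    and ij: "i \<in> C p" "j \<in> C p"
  shows "V t $ i = V t $ j"
proof -
  have per': "V (t + m * T) = V t" for t m
    by (induction m) (simp_all add: per flip: add.assoc add: add.commute[of T])
  \<comment> \<open>By periodicity the times below \<open>T\<close> already give all spreads, so
    this set is finite and has a maximum.\<close>
  define S where "S = (\<lambda>(t, i, i'). V t $ i - V t $ i') ` ({..<T} \<times> (\<Union>p. C p \<times> C p))"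
  define D where "D = Max S"
  have fin: "finite S" unfolding S_def by simp
  have S_mem: "V t $ i - V t $ i' \<in> S" if "i \<in> C p" "i' \<in> C p" for t i i' p
  proof -
    have "V t = V (t mod T)"
      using per'[of "t mod T" "t div T"] by simp
    then show ?thesis
      unfolding S_def using that T by (intro image_eqI[of _ _ "(t mod T, i, i')"]) auto
  qed
  have spread: "cluster_spread_le C (V t) D" for t
    unfolding D_def cluster_spread_le_def using Max_ge[OF fin S_mem] by blast
  have "D \<in> S"
    unfolding D_def using fin S_mem[OF ij] by (intro Max_in) auto
  then obtain s a a' r where a: "a \<in> C r" "a' \<in> C r" "V s $ a - V s $ a' = D"
    unfolding S_def by auto
  obtain v where "(v, a) \<in> (matrix_graph A)\<^sup>*" "(v, a') \<in> (matrix_graph A)\<^sup>*"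
    using trees a unfolding cluster_spanning_trees_def by blast
  then obtain m1 m2 where m12: "(v, a) \<in> matrix_graph A ^^ m1" "(v, a') \<in> matrix_graph A ^^ m2"
    using rtrancl_imp_relpow by meson
  define m where "m = max m1 m2"
  have loops: "(i, i) \<in> matrix_graph A" for i
    using diag by (simp add: matrix_graph_def)
  have m: "(v, a) \<in> matrix_graph A ^^ m" "(v, a') \<in> matrix_graph A ^^ m"
    by (auto simp: m_def intro: relpow_mono_reflexive[OF loops m12(1)]
        relpow_mono_reflexive[OF loops m12(2)])
  \<comment> \<open>\<open>m\<close> full periods are added to \<open>s\<close> before going back
    \<open>m\<close> steps, which makes the subtraction on naturals exact.\<close>
  define t' where "t' = s + m * T - m"
  have "m \<le> m * T" using T by simp
  then have "t' + m = s + m * T" unfolding t'_def by linarith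
  then have s: "V (t' + m) = V s" by (simp add: per')
  obtain q c where c: "c \<in> C q" "v \<in> C q" "V t' $ v - V t' $ c = D"
    using cluster_spread_attained_ancestor[where V = V and t = t' and m = m, OF C A rec spread a(1,2) _ m(1)] a(3) s
    by auto
  obtain q' d where d: "d \<in> C q'" "v \<in> C q'" "V t' $ d - V t' $ v = D"
  proof -
    \<comment> \<open>The same lemma is applied to \<open>- V\<close> with \<open>a\<close> and
      \<open>a'\<close> exchanged: it yields a vertex \<open>D\<close> above \<open>v\<close>
      instead of below.\<close>
    have "- V (Suc t) = A *v (- V t) + cluster_vector C (- b t)" for t
      by (simp add: rec vec_eq_iff cluster_vector_def matrix_vector_mult_def sum_negf)
    moreover have "cluster_spread_le C (- V t) D" for t
      using spread[of t] by (simp add: cluster_spread_le_def)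
    moreover have "(- V (t' + m)) $ a' - (- V (t' + m)) $ a = D"
      using a(3) s by simp
    ultimately have "\<exists>q. \<exists>j'\<in>C q. v \<in> C q \<and> (- V t') $ v - (- V t') $ j' = D"
      by (rule cluster_spread_attained_ancestor[where V = "\<lambda>t. - V t" and b = "\<lambda>t. - b t",
            OF C A _ _ a(2,1) _ m(2)])
    then show thesis using that by auto
  qed
  have "q' = q"
    using clustering_the_eq[OF C c(2)] clustering_the_eq[OF C d(2)] by simp
  then have "D \<le> 0"
    using cluster_spread_leD[OF spread[of t'], of d q c] c d by simp
  then show ?thesis
    using cluster_spread_leD[OF spread ij, of t] cluster_spread_leD[OF spread ij(2,1), of t] by simp
qed

section \<open>Gap increments and their dependence on \<alpha>\<close>

lemma trajectory_add:
  fixes B :: "real ^ 'm ^ 'm"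
  shows "trajectory B (a + b) w 0 t = trajectory B a w 0 t + trajectory B b w 0 t"
  by (induction t) (simp_all add: matrix_vector_right_distrib scaleR_add_right)

lemma trajectory_scaleR:
  fixes B :: "real ^ 'm ^ 'm"
  shows "trajectory B (c *\<^sub>R a) w 0 t = c *\<^sub>R trajectory B a w 0 t"
  by (induction t) (simp_all add: matrix_vector_mult_scaleR scaleR_add_right)

lemma trajectory_matrix_vector_mult:
  fixes B :: "real ^ 'm ^ 'm"
  shows "trajectory B (B *v a) w 0 t = B *v trajectory B a w 0 t"
  by (induction t) (simp_all add: matrix_vector_right_distrib matrix_vector_mult_scaleR)

text \<open>Increments are taken instead of the gap because changing the initial state alters the
  gap by a convergent term, which the increments lose in the limit.\<close>

definition gap_increment ::
    "real ^ 'm ^ 'm \<Rightarrow> real ^ 'm \<Rightarrow> (nat \<Rightarrow> real) \<Rightarrow> 'm \<Rightarrow> 'm \<Rightarrow> nat \<Rightarrow> real" where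
  "gap_increment B \<alpha> w k l t =
     (trajectory B \<alpha> w 0 (Suc t) $ k - trajectory B \<alpha> w 0 (Suc t) $ l) -
     (trajectory B \<alpha> w 0 t $ k - trajectory B \<alpha> w 0 t $ l)"

text \<open>The solution for \<open>B *v \<alpha>\<close> is \<open>B\<close> times the solution for
  \<open>\<alpha>\<close>, so one step trades \<open>\<alpha>\<close> for
  \<open>B *v \<alpha>\<close> and exposes an increment of the input.\<close>

lemma gap_increment_Suc:
  "gap_increment B \<alpha> w k l (Suc t) =
     gap_increment B (B *v \<alpha>) w k l t + (w (Suc t) - w t) * (\<alpha> $ k - \<alpha> $ l)"
  by (simp add: gap_increment_def trajectory_matrix_vector_mult algebra_simps)

lemma subspace_gap_increment_null:
  "subspace {\<alpha>. gap_increment B \<alpha> w k l \<longlonglongrightarrow> 0}"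
proof (rule subspaceI)
  have add: "gap_increment B (a + b) w k l t = gap_increment B a w k l t + gap_increment B b w k l t"
    for a b t
    by (simp add: gap_increment_def trajectory_add del: trajectory.simps)
  have scale: "gap_increment B (c *\<^sub>R a) w k l t = c * gap_increment B a w k l t" for c a t
    by (simp add: gap_increment_def trajectory_scaleR right_diff_distrib del: trajectory.simps)
  show "0 \<in> {\<alpha>. gap_increment B \<alpha> w k l \<longlonglongrightarrow> 0}"
    using scale[of 0 0] by (simp add: tendsto_eventually)
  show "a + b \<in> {\<alpha>. gap_increment B \<alpha> w k l \<longlonglongrightarrow> 0}"
    if "a \<in> {\<alpha>. gap_increment B \<alpha> w k l \<longlonglongrightarrow> 0}" "b \<in> {\<alpha>. gap_increment B \<alpha> w k l \<longlonglongrightarrow> 0}"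
    for a b
    using tendsto_add[of _ 0 sequentially _ 0] that by (force simp: add[abs_def])
  show "c *\<^sub>R a \<in> {\<alpha>. gap_increment B \<alpha> w k l \<longlonglongrightarrow> 0}"
    if "a \<in> {\<alpha>. gap_increment B \<alpha> w k l \<longlonglongrightarrow> 0}" for c a
    using tendsto_mult_right_zero that by (auto simp: scale[abs_def])
qed

text \<open>
  If no direction \<open>\<alpha>\<close> separated \<open>k\<close> from \<open>l\<close>, then comparing \<open>\<alpha>\<close> with \<open>B *v \<alpha>\<close> would force the
  increments of the periodic input \<open>w\<close> to vanish.
\<close>

lemma gap_increment_null_proper:
  fixes B :: "real ^ 'm ^ 'm"
  assumes "k \<noteq> l" and per: "\<And>t. w (t + T) = w t" and "T > 0" and w: "w (Suc t0) \<noteq> w t0"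
  shows "{\<alpha>. gap_increment B \<alpha> w k l \<longlonglongrightarrow> 0} \<noteq> UNIV"
proof
  assume "{\<alpha>. gap_increment B \<alpha> w k l \<longlonglongrightarrow> 0} = UNIV"
  then have null: "gap_increment B \<alpha> w k l \<longlonglongrightarrow> 0" for \<alpha> by blast
  \<comment> \<open>This choice gives the input increment the coefficient \<open>1\<close> in
    \<open>gap_increment_Suc\<close>.\<close>
  define a :: "real ^ 'm" where "a = axis k 1"
  have "(\<lambda>t. gap_increment B a w k l (Suc t) - gap_increment B (B *v a) w k l t) \<longlonglongrightarrow> 0"
    using tendsto_diff[OF LIMSEQ_Suc[OF null] null] by simp
  moreover have "a $ k - a $ l = 1"
    using \<open>k \<noteq> l\<close> by (simp add: a_def axis_def)
  ultimately have lim: "(\<lambda>t. w (Suc t) - w t) \<longlonglongrightarrow> 0"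
    by (simp add: gap_increment_Suc)
  have per': "w (t + n * T) = w t" for t n
    by (induction n) (simp_all add: per flip: add.assoc add: add.commute[of T])
  \<comment> \<open>Along the times congruent to \<open>t0\<close> modulo \<open>T\<close> the input
    increment is constant.\<close>
  have "strict_mono (\<lambda>n. t0 + n * T)"
    using \<open>T > 0\<close> by (simp add: strict_mono_def)
  from LIMSEQ_subseq_LIMSEQ[OF lim this] have "(\<lambda>n. w (Suc t0) - w t0) \<longlonglongrightarrow> 0"
    using per'[of "Suc t0"] per'[of t0] by (simp add: o_def)
  with w show False by (simp add: LIMSEQ_const_iff)
qed

section \<open>Exceptional sets of measure zero\<close>

lemma AE_not_in_proper_subspace:
  fixes W :: "'a::euclidean_space set"
  assumes "subspace W" "W \<noteq> UNIV"
  shows "AE x in lborel. x \<notin> W"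
proof -
  have "dim W < DIM('a)"
    using assms by (metis dim_eq_full dim_subset_UNIV le_neq_implies_less span_eq_iff)
  then have "W \<in> null_sets lebesgue"
    using negligible_lowdim negligible_iff_null_sets by blast
  moreover have "W \<in> sets lborel"
    using closed_subspace[OF assms(1)] by simp
  ultimately have "W \<in> null_sets lborel"
    by (simp add: null_sets_completion_iff)
  then show ?thesis
    by (rule AE_not_in)
qed

lemma periodic_input_add_period: "periodic_input T u (t + T) = periodic_input T u t"
  by (simp add: periodic_input_def)

lemma sum_periodic_input:
  assumes "T > 0"
  shows "(\<Sum>t<T. periodic_input T u t) = 0"
proof -
  have "{..<T} = insert 0 {1..<T}"
    using assms by auto
  then show ?thesis
    by (simp add: periodic_input_def)
qed

text \<open>A constant input with sum \<open>0\<close> over a period is \<open>0\<close>, which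
  contradicts its value \<open>u 1\<close> at time \<open>1\<close>.\<close>

lemma periodic_input_not_constant:
  assumes "T \<ge> 2" "u 1 \<noteq> 0"
  shows "\<exists>t. periodic_input T u (Suc t) \<noteq> periodic_input T u t"
proof (rule ccontr)
  assume "\<nexists>t. periodic_input T u (Suc t) \<noteq> periodic_input T u t"
  then have "periodic_input T u t = periodic_input T u 0" for t
    by (induction t) auto
  \<comment> \<open>The value is read off at time \<open>1\<close>, where \<open>T \<ge> 2\<close>
    gives \<open>1 mod T = 1\<close>.\<close>
  then have "periodic_input T u t = u 1" for t
    using \<open>T \<ge> 2\<close> by (metis One_nat_def Suc_1 Suc_le_lessD mod_less periodic_input_def zero_neq_one)
  then show False
    using sum_periodic_input[of T u] assms by simp
qed

lemma AE_gap_increment_not_null: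
  fixes B :: "real ^ 'm ^ 'm"
  assumes "T \<ge> 2" "u 1 \<noteq> 0"
  shows "AE \<alpha> in lborel. \<forall>k l. k \<noteq> l \<longrightarrow> \<not> gap_increment B \<alpha> (periodic_input T u) k l \<longlonglongrightarrow> 0"
proof -
  obtain t0 where t0: "periodic_input T u (Suc t0) \<noteq> periodic_input T u t0"
    using periodic_input_not_constant[where u = u, OF assms] by blast
  have "AE \<alpha> in lborel. k \<noteq> l \<longrightarrow> \<not> gap_increment B \<alpha> (periodic_input T u) k l \<longlonglongrightarrow> 0" for k l
  proof (cases "k = l")
    case False
    then have "AE \<alpha> in lborel. \<alpha> \<notin> {\<alpha>. gap_increment B \<alpha> (periodic_input T u) k l \<longlonglongrightarrow> 0}"
      using assms(1) t0
      by (intro AE_not_in_proper_subspace subspace_gap_increment_null gap_increment_null_proper[where T = T])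
         (auto simp: periodic_input_add_period)
    then show ?thesis by eventually_elim simp
  qed simp
  then show ?thesis
    by (simp add: AE_all_countable)
qed

text \<open>The exceptional set lies in a box with the null side \<open>{c}\<close>.\<close>

lemma AE_PiM_lborel_component_neq:
  assumes "finite I" "i \<in> I"
  shows "AE u in PiM I (\<lambda>_. lborel). u i \<noteq> (c :: real)"
proof (rule AE_I)
  interpret product_sigma_finite "\<lambda>_. lborel :: real measure" ..
  let ?A = "\<lambda>j. if j = i then {c} else UNIV"
  show "{u \<in> space (PiM I (\<lambda>_. lborel)). \<not> u i \<noteq> c} \<subseteq> Pi\<^sub>E I ?A"
    by (auto simp: space_PiM PiE_iff extensional_def)
  show "Pi\<^sub>E I ?A \<in> sets (PiM I (\<lambda>_. lborel))"
    using assms by (intro sets_PiM_I_finite) auto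
  have "emeasure (PiM I (\<lambda>_. lborel)) (Pi\<^sub>E I ?A) = (\<Prod>j\<in>I. emeasure lborel (?A j))"
    using assms by (intro emeasure_PiM) auto
  also have "\<dots> = 0"
    using assms by (intro prod_zero bexI[of _ i]) auto
  finally show "emeasure (PiM I (\<lambda>_. lborel)) (Pi\<^sub>E I ?A) = 0" .
qed

section \<open>Measurability and the product measure on triples\<close>

text \<open>All quantifiers on the right are countable, which makes convergence to \<open>0\<close>
  a measurable predicate.\<close>

lemma tendsto_zero_iff_inverse_Suc:
  fixes X :: "nat \<Rightarrow> real"
  shows "X \<longlonglongrightarrow> 0 \<longleftrightarrow> (\<forall>n. \<exists>N. \<forall>t\<ge>N. \<bar>X t\<bar> < inverse (real (Suc n)))"
proof
  assume "X \<longlonglongrightarrow> 0"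
  then show "\<forall>n. \<exists>N. \<forall>t\<ge>N. \<bar>X t\<bar> < inverse (real (Suc n))"
    unfolding LIMSEQ_iff by simp
next
  assume X: "\<forall>n. \<exists>N. \<forall>t\<ge>N. \<bar>X t\<bar> < inverse (real (Suc n))"
  show "X \<longlonglongrightarrow> 0"
  proof (rule LIMSEQ_I)
    fix r :: real assume "0 < r"
    then obtain n where n: "inverse (real (Suc n)) < r"
      using reals_Archimedean by blast
    from X obtain N where "\<And>t. t \<ge> N \<Longrightarrow> \<bar>X t\<bar> < inverse (real (Suc n))"
      by blast
    with n show "\<exists>N. \<forall>t\<ge>N. norm (X t - 0) < r"
      by (auto intro!: exI[of _ N] intro: less_trans)
  qed
qed

lemma measurable_periodic_input [measurable]:
  assumes "T > 0"
  shows "(\<lambda>u. periodic_input T u t) \<in> borel_measurable (PiM {1..<T} (\<lambda>_. lborel))"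
proof (cases "t mod T = 0")
  case False
  then have "t mod T \<in> {1..<T}" using assms by simp
  then show ?thesis
    using False by (simp add: periodic_input_def)
qed (simp add: periodic_input_def)

text \<open>The induction treats all coordinates at once, since each new coordinate is a sum over
  all old ones.\<close>

lemma measurable_trajectory_nth:
  fixes N :: "(real ^ 'm ^ 'm) measure"
  assumes N [measurable_cong]: "sets N = sets borel" and [simp]: "T > 0"
  shows "(\<lambda>x. trajectory (fst x) (fst (snd x)) (periodic_input T (snd (snd x))) 0 t $ k)
    \<in> borel_measurable (N \<Otimes>\<^sub>M (lborel \<Otimes>\<^sub>M PiM {1..<T} (\<lambda>_. lborel)))"
proof (induction t arbitrary: k)
  case (Suc t)
  note Suc [measurable]
  have [measurable]: "(\<lambda>B :: real ^ 'm ^ 'm. B $ i $ j) \<in> borel_measurable borel" for i j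
    by (intro borel_measurable_continuous_onI continuous_intros)
  have [measurable]: "(\<lambda>a :: real ^ 'm. a $ i) \<in> borel_measurable borel" for i
    by (intro borel_measurable_continuous_onI continuous_intros)
  show ?case
    unfolding trajectory.simps matrix_vector_mult_def vector_add_component vector_scaleR_component
      vec_lambda_beta
    by measurable
qed simp

lemma pred_gap_increment_not_null:
  fixes N :: "(real ^ 'm ^ 'm) measure"
  assumes "sets N = sets borel" "T > 0"
  shows "Measurable.pred (N \<Otimes>\<^sub>M (lborel \<Otimes>\<^sub>M PiM {1..<T} (\<lambda>_. lborel)))
    (\<lambda>x. \<forall>k l. k \<noteq> l \<longrightarrow>
      \<not> gap_increment (fst x) (fst (snd x)) (periodic_input T (snd (snd x))) k l \<longlonglongrightarrow> 0)"
proof -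
  note measurable_trajectory_nth[OF assms, measurable]
  show ?thesis
    unfolding tendsto_zero_iff_inverse_Suc gap_increment_def by measurable
qed

text \<open>Only the second factor has to be \<open>\<sigma>\<close>-finite here, unlike in \<open>pair_sigma_finite.AE_pair_measure\<close>.\<close>

lemma (in sigma_finite_measure) AE_pair_measure_right:
  assumes P: "Measurable.pred (N \<Otimes>\<^sub>M M) P" and ae: "\<And>x. x \<in> space N \<Longrightarrow> AE y in M. P (x, y)"
  shows "AE z in N \<Otimes>\<^sub>M M. P z"
proof (subst AE_iff_measurable[OF _ refl])
  show sets: "{z \<in> space (N \<Otimes>\<^sub>M M). \<not> P z} \<in> sets (N \<Otimes>\<^sub>M M)"
    using P by measurable
  have "emeasure (N \<Otimes>\<^sub>M M) {z \<in> space (N \<Otimes>\<^sub>M M). \<not> P z} =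
      (\<integral>\<^sup>+ x. \<integral>\<^sup>+ y. indicator {z \<in> space (N \<Otimes>\<^sub>M M). \<not> P z} (x, y) \<partial>M \<partial>N)"
    by (rule emeasure_pair_measure[OF sets])
  also have "\<dots> = (\<integral>\<^sup>+ x. \<integral>\<^sup>+ y. 0 \<partial>M \<partial>N)"
  proof (rule nn_integral_cong)
    fix x assume "x \<in> space N"
    from ae[OF this]
    have "AE y in M. indicator {z \<in> space (N \<Otimes>\<^sub>M M). \<not> P z} (x, y) = (0 :: ennreal)"
      by eventually_elim simp
    then show "(\<integral>\<^sup>+ y. indicator {z \<in> space (N \<Otimes>\<^sub>M M). \<not> P z} (x, y) \<partial>M) = (\<integral>\<^sup>+ y. 0 \<partial>M)"
      by (rule nn_integral_cong_AE)
  qed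
  finally show "emeasure (N \<Otimes>\<^sub>M M) {z \<in> space (N \<Otimes>\<^sub>M M). \<not> P z} = 0" by simp
qed

text \<open>Each section over a fixed \<open>B\<close> is handled separately. There \<open>u\<close>
  with \<open>u 1 \<noteq> 0\<close> comes first, because the bad set of \<open>\<alpha>\<close>
  depends on it; measurability then permits exchanging the order of the two.\<close>

lemma AE_triple_gap_increment_not_null:
  fixes N :: "(real ^ 'm ^ 'm) measure"
  assumes N: "sets N = sets borel" and T: "T \<ge> 2"
  shows "AE (B, \<alpha>, u) in N \<Otimes>\<^sub>M (lborel \<Otimes>\<^sub>M PiM {1..<T} (\<lambda>_. lborel)).
    \<forall>k l. k \<noteq> l \<longrightarrow> \<not> gap_increment B \<alpha> (periodic_input T u) k l \<longlonglongrightarrow> 0"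
proof -
  interpret product_sigma_finite "\<lambda>_. lborel :: real measure" ..
  interpret P: sigma_finite_measure "PiM {1..<T} (\<lambda>_. lborel :: real measure)"
    by (rule sigma_finite) simp
  interpret Q: pair_sigma_finite "lborel :: (real ^ 'm) measure" "PiM {1..<T} (\<lambda>_. lborel :: real measure)" ..
  let ?P = "\<lambda>B \<alpha> u. \<forall>k l. k \<noteq> l \<longrightarrow> \<not> gap_increment B \<alpha> (periodic_input T u) k l \<longlonglongrightarrow> 0"
  have "T > 0" using T by simp
  note pred = pred_gap_increment_not_null[OF N this]
  have "AE x in N \<Otimes>\<^sub>M (lborel \<Otimes>\<^sub>M PiM {1..<T} (\<lambda>_. lborel)). ?P (fst x) (fst (snd x)) (snd (snd x))"
  proof (rule Q.AE_pair_measure_right[OF pred])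
    fix B assume B: "B \<in> space N"
    have predB: "Measurable.pred (lborel \<Otimes>\<^sub>M PiM {1..<T} (\<lambda>_. lborel)) (\<lambda>y. ?P B (fst y) (snd y))"
      using measurable_compose[OF measurable_Pair1'[OF B] pred] by simp
    have "AE u in PiM {1..<T} (\<lambda>_. lborel). u 1 \<noteq> (0 :: real)"
      using T by (intro AE_PiM_lborel_component_neq) auto
    then have "AE u in PiM {1..<T} (\<lambda>_. lborel). AE \<alpha> in lborel. ?P B \<alpha> u"
      by eventually_elim (rule AE_gap_increment_not_null[OF T])
    then have "AE \<alpha> in lborel. AE u in PiM {1..<T} (\<lambda>_. lborel). ?P B \<alpha> u"
      using Q.AE_commute[of "?P B"] predB by (simp add: pred_def)
    then have "AE y in lborel \<Otimes>\<^sub>M PiM {1..<T} (\<lambda>_. lborel). ?P B (fst y) (snd y)"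
      using predB by (intro Q.AE_pair_measure) (simp_all add: pred_def)
    then show "AE y in lborel \<Otimes>\<^sub>M PiM {1..<T} (\<lambda>_. lborel).
        ?P (fst (B, y)) (fst (snd (B, y))) (snd (snd (B, y)))"
      by simp
  qed
  then show ?thesis
    by (simp add: case_prod_unfold)
qed

section \<open>From gap increments to cluster consensus\<close>

lemma limsup_abs_pos_iff:
  fixes X :: "nat \<Rightarrow> real"
  shows "limsup (\<lambda>t. ereal \<bar>X t\<bar>) > 0 \<longleftrightarrow> \<not> X \<longlonglongrightarrow> 0"
proof
  assume "\<not> X \<longlonglongrightarrow> 0"
  then have "\<not> (\<lambda>t. \<bar>X t\<bar>) \<longlonglongrightarrow> 0"
    by (simp add: tendsto_rabs_zero_iff)
  moreover have "(0 :: ereal) \<le> liminf (\<lambda>t. ereal \<bar>X t\<bar>)"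
    by (rule Liminf_bounded) simp
  ultimately show "limsup (\<lambda>t. ereal \<bar>X t\<bar>) > 0"
    using limsup_le_liminf_real[of "\<lambda>t. \<bar>X t\<bar>" 0] by (force simp: zero_ereal_def not_le)
next
  assume "limsup (\<lambda>t. ereal \<bar>X t\<bar>) > 0"
  moreover have "limsup (\<lambda>t. ereal \<bar>X t\<bar>) = 0" if "X \<longlonglongrightarrow> 0"
    using that by (intro lim_imp_Limsup) (auto simp: zero_ereal_def tendsto_rabs_zero_iff)
  ultimately show "\<not> X \<longlonglongrightarrow> 0" by force
qed

text \<open>By linearity the trajectory from \<open>x\<close> is the one from \<open>0\<close> plus
  the powers of \<open>A\<close> applied to \<open>x\<close>. These powers converge, so their
  increments tend to \<open>0\<close>. If the gap between two clusters tended to \<open>0\<close>,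
  the increments of the gap for the start \<open>0\<close> would do so too.\<close>

lemma not_gap_increment_null_imp_separates:
  fixes A :: "real ^ 'n ^ 'n" and C :: "'k::finite \<Rightarrow> 'n set"
  assumes C: "clustering C" and A: "stochastic A" "common_influence C A"
    and diag: "\<And>i. A $ i $ i > 0"
    and sep: "\<And>k l. k \<noteq> l \<Longrightarrow> \<not> gap_increment (inter_cluster_matrix C A) \<alpha> w k l \<longlonglongrightarrow> 0"
  shows "inter_cluster_separates C (trajectory A (cluster_vector C \<alpha>) w x)"
  unfolding inter_cluster_separates_def limsup_abs_pos_iff
proof (intro allI impI ballI notI)
  let ?x = "trajectory A (cluster_vector C \<alpha>) w x"
  let ?y = "trajectory A (cluster_vector C \<alpha>) w 0"
  fix k l i j
  assume "k \<noteq> l" and i: "i \<in> C k" and j: "j \<in> C l" and lim: "(\<lambda>t. ?x t $ i - ?x t $ j) \<longlonglongrightarrow> 0"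
  \<comment> \<open>The start \<open>0\<close> is constant on clusters, so \<open>?y\<close> is
    governed by the inter-cluster matrix.\<close>
  have zero: "cluster_vector C 0 = 0"
    by (simp add: cluster_vector_def vec_eq_iff)
  have y: "?y t $ i = trajectory (inter_cluster_matrix C A) \<alpha> w 0 t $ p" if "i \<in> C p" for t i p
    using trajectory_cluster_vector[OF C A(2), of \<alpha> w 0 t] cluster_vector_nth[OF C that]
    by (simp add: zero)
  obtain L where L: "(\<lambda>t. ((*v) A ^^ t) x) \<longlonglongrightarrow> L"
    using stochastic_funpow_convergent[OF A(1) diag] by blast
  define z where "z t = ((*v) A ^^ t) x $ i - ((*v) A ^^ t) x $ j" for t
  have z: "z \<longlonglongrightarrow> L $ i - L $ j"
    unfolding z_def by (intro tendsto_intros L)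
  have z': "(\<lambda>t. z (Suc t) - z t) \<longlonglongrightarrow> 0"
    using tendsto_diff[OF LIMSEQ_Suc[OF z] z] by simp
  have "(\<lambda>t. (?x (Suc t) $ i - ?x (Suc t) $ j) - (?x t $ i - ?x t $ j)) \<longlonglongrightarrow> 0"
    using tendsto_diff[OF LIMSEQ_Suc[OF lim] lim] by simp
  from tendsto_diff[OF this z']
  have "(\<lambda>t. ((?x (Suc t) $ i - ?x (Suc t) $ j) - (?x t $ i - ?x t $ j))
      - (z (Suc t) - z t)) \<longlonglongrightarrow> 0"
    by (simp only: diff_zero)
  moreover have "((?x (Suc t) $ i - ?x (Suc t) $ j) - (?x t $ i - ?x t $ j)) - (z (Suc t) - z t)
      = gap_increment (inter_cluster_matrix C A) \<alpha> w k l t" for t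
  proof -
    have "z t = (?x t $ i - ?x t $ j) - (?y t $ i - ?y t $ j)" for t
      using arg_cong[OF trajectory_diff[of A "cluster_vector C \<alpha>" w x t 0], of "\<lambda>v. v $ i - v $ j"]
      by (simp add: z_def)
    then show ?thesis
      unfolding gap_increment_def by (simp add: y[OF i] y[OF j] del: trajectory.simps)
  qed
  ultimately have "gap_increment (inter_cluster_matrix C A) \<alpha> w k l \<longlonglongrightarrow> 0"
    by (simp del: trajectory.simps)
  with sep[OF \<open>k \<noteq> l\<close>] show False ..
qed

text \<open>The trajectory approaches a periodic one, and a periodic one is exactly constant on
  clusters at every time; its common values form \<open>v\<close>.\<close>

lemma stochastic_cluster_periodic_limit:
  fixes A :: "real ^ 'n ^ 'n" and C :: "'k::finite \<Rightarrow> 'n set"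
  assumes C: "clustering C" and A: "stochastic A" "common_influence C A"
    and diag: "\<And>i. A $ i $ i > 0"
    and trees: "cluster_spanning_trees C (matrix_graph A)"
    and T: "T > 0" and w: "\<And>t. w (t + T) = w t" "(\<Sum>i<T. w i) = 0"
  obtains v where "\<And>t. v (t + T) = v t"
    "(\<lambda>t. trajectory A (cluster_vector C \<alpha>) w x t - cluster_vector C (v t)) \<longlonglongrightarrow> 0"
proof -
  obtain V0 where V0: "\<And>t. trajectory A (cluster_vector C \<alpha>) w V0 (t + T) =
        trajectory A (cluster_vector C \<alpha>) w V0 t"
      "(\<lambda>t. trajectory A (cluster_vector C \<alpha>) w x t - trajectory A (cluster_vector C \<alpha>) w V0 t)
        \<longlonglongrightarrow> 0"
    using stochastic_periodic_trajectory[OF A(1) diag T w,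
        where s = "cluster_vector C \<alpha>" and x = x] by blast
  let ?V = "trajectory A (cluster_vector C \<alpha>) w V0"
  have const: "?V t $ i = ?V t $ j" if "i \<in> C p" "j \<in> C p" for t i j p
  proof (rule periodic_solution_cluster_constant[OF C A diag trees _ _ T that])
    show "?V (Suc t) = A *v ?V t + cluster_vector C (w t *\<^sub>R \<alpha>)" for t
      by (simp add: cluster_vector_def vec_eq_iff)
  qed (rule V0)
  define v :: "nat \<Rightarrow> real ^ 'k" where "v t = (\<chi> p. ?V t $ (SOME i. i \<in> C p))" for t
  have "?V t = cluster_vector C (v t)" for t
    unfolding cluster_vector_eq_iff[OF C] v_def vec_lambda_beta
    by (intro allI ballI const[OF _ someI])
  then show thesis
    using V0 by (intro that[of v]) (simp_all add: v_def)
qed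

theorem theorem2:
  fixes C :: "'k::finite \<Rightarrow> 'n::finite set"
    and G :: "('n \<times> 'n) set"
    and T :: nat
  assumes "clustering C"
    and "T \<ge> 2"
    and self_links: "\<And>i. (i, i) \<in> G"
    and "\<And>p q. (\<forall>v\<in>C p. \<forall>w\<in>C q. (w, v) \<notin> G) \<or> (\<forall>v\<in>C p. \<exists>w\<in>C q. (w, v) \<in> G)"
    and "cluster_spanning_trees C G"
  shows "AE (B, \<alpha>, u) in triple_measure T C G. (B, \<alpha>, u) \<in> triples T C G \<longrightarrow>
           (\<forall>A. stochastic A \<and> matrix_graph A = G \<and> common_influence C A \<and>
                inter_cluster_matrix C A = B \<longrightarrow>
              (AE x0 in lborel.
                 let x = trajectory A (cluster_vector C \<alpha>) (periodic_input T u) x0 in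
                   cluster_consensus C x \<and>
                   (\<exists>v :: 'k \<Rightarrow> nat \<Rightarrow> real.
                      (\<forall>p t. v p (t + T) = v p t) \<and>
                      (\<forall>p. \<forall>j\<in>C p. (\<lambda>t. \<bar>x t $ j - v p t\<bar>) \<longlonglongrightarrow> 0))))"
proof -
  have C: "clustering C" by fact
  have consensus: "cluster_consensus C x \<and>
      (\<exists>v :: 'k \<Rightarrow> nat \<Rightarrow> real. (\<forall>p t. v p (t + T) = v p t) \<and>
        (\<forall>p. \<forall>j\<in>C p. (\<lambda>t. \<bar>x t $ j - v p t\<bar>) \<longlonglongrightarrow> 0))"
    if sep: "\<forall>k l. k \<noteq> l \<longrightarrow>
        \<not> gap_increment B \<alpha> (periodic_input T u) k l \<longlonglongrightarrow> 0"
      and A: "stochastic A" "matrix_graph A = G" "common_influence C A" "inter_cluster_matrix C A = B"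
      and x: "x = trajectory A (cluster_vector C \<alpha>) (periodic_input T u) x0"
    for B \<alpha> u A x x0
  proof -
    have diag: "A $ i $ i > 0" for i
      using self_links[of i] A(2) by (auto simp: matrix_graph_def)
    have trees: "cluster_spanning_trees C (matrix_graph A)"
      using assms(5) A(2) by simp
    have T: "T > 0" using \<open>T \<ge> 2\<close> by simp
    obtain v where v: "\<And>t. v (t + T) = v t" "(\<lambda>t. x t - cluster_vector C (v t)) \<longlonglongrightarrow> 0"
      using stochastic_cluster_periodic_limit[OF C A(1,3) diag trees T,
          where w = "periodic_input T u" and \<alpha> = \<alpha> and x = x0]
        periodic_input_add_period sum_periodic_input[OF T] unfolding x by blast
    have lim: "(\<lambda>t. x t $ j - v t $ p) \<longlonglongrightarrow> 0" if "j \<in> C p" for j p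
      using tendsto_vec_nth[OF v(2), of j] by (simp add: cluster_vector_nth[OF C that])
    \<comment> \<open>Periodicity leaves finitely many values of \<open>v\<close>, and the remainder
      converges, so \<open>x\<close> is bounded.\<close>
    have "v t = v (t mod T)" for t
    proof -
      have "v (t + m * T) = v t" for t m
        by (induction m) (simp_all add: v(1) flip: add.assoc add: add.commute[of T])
      from this[of "t mod T" "t div T"] show ?thesis by simp
    qed
    then have "range (\<lambda>t. cluster_vector C (v t)) \<subseteq> (\<lambda>t. cluster_vector C (v t)) ` {..<T}"
      using T by (metis (no_types, lifting) image_eqI image_subsetI lessThan_iff mod_less_divisor)
    then have "bounded (range (\<lambda>t. cluster_vector C (v t)))"
      using finite_imp_bounded finite_subset by (metis finite_imageI finite_lessThan)
    moreover have "bounded (range (\<lambda>t. x t - cluster_vector C (v t)))"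
      using v(2) by (rule convergent_imp_bounded)
    ultimately have "bounded (range (\<lambda>t. (x t - cluster_vector C (v t)) + cluster_vector C (v t)))"
      by (rule bounded_plus_comp[rotated])
    then have "bounded (range x)" by simp
    moreover have "intra_cluster_synchronizes C x"
      unfolding intra_cluster_synchronizes_def
    proof (intro allI ballI)
      fix p i i' assume "i \<in> C p" "i' \<in> C p"
      from tendsto_diff[OF lim[OF this(1)] lim[OF this(2)]]
      show "(\<lambda>t. \<bar>x t $ i - x t $ i'\<bar>) \<longlonglongrightarrow> 0"
        by (intro tendsto_rabs_zero) simp
    qed
    moreover have "inter_cluster_separates C x"
      unfolding x using sep A(4) by (intro not_gap_increment_null_imp_separates C A diag) auto
    ultimately have "cluster_consensus C x"
      by (simp add: cluster_consensus_def)
    moreover have "(\<forall>p t. v (t + T) $ p = v t $ p) \<and>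
        (\<forall>p. \<forall>j\<in>C p. (\<lambda>t. \<bar>x t $ j - v t $ p\<bar>) \<longlonglongrightarrow> 0)"
      using v(1) lim by (auto intro: tendsto_rabs_zero)
    ultimately show ?thesis
      by (intro conjI exI[of _ "\<lambda>p t. v t $ p"]) auto
  qed
  have sets: "sets (lborel_affine S) = sets borel" for S :: "(real ^ 'k ^ 'k) set"
    by (simp add: lborel_affine_def Let_def)
  \<comment> \<open>For a triple outside the exceptional set \<open>consensus\<close> holds for
    every \<open>x0\<close>, so the inner almost-everywhere claim follows by
    \<open>AE_I2\<close>.\<close>
  from AE_triple_gap_increment_not_null[OF sets \<open>T \<ge> 2\<close>, of "affine hull (admissible_matrices C G)"]
  show ?thesis
    unfolding triple_measure_def
    by (rule eventually_mono)
       (simp only: split_paired_all prod.case, intro impI allI, elim conjE, rule AE_I2,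
        unfold Let_def, rule consensus[OF _ _ _ _ _ refl])
qed

end
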